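(* Let $v\in S$ be a nonzero sedenion and write $v=v_1+v_2e_8$, $v_1=x_1e_0+u$, $v_2=x_2e_0+w$ with $x_1,x_2\in\mathbb{R}$ and $u,w\in\operatorname{Im}(\mathbb{O})$. Then $v$ is a left zero-divisor if and only if \[ x_1=x_2=0,\qquad \|u\|=\|w\|,\qquad \langle u,w\rangle=0 . \]
   Context: $\mathbb{O}$ is the real algebra of octonions with unit $e_0=1$, conjugation $x\mapsto\overline{x}$, standard Euclidean inner product $\langle\cdot,\cdot\rangle$ and norm $\|\cdot\|$ on $\mathbb{O}\cong\mathbb{R}^8$ (so $x\overline{x}=\|x\|^2e_0$), and $\operatorname{Im}(\mathbb{O})=e_0^{\perp}\cong\mathbb{R}^7$ its subspace of purely imaginary octonions. Concretely, $\mathbb{O}=\mathbb{H}\oplus\mathbb{H}e_4$ with product $(x+ye_4)(z+te_4)=(xz-\overline{t}\,y)+(tx+y\overline{z})e_4$ and conjugation $\overline{x+ye_4}=\overline{x}-ye_4$, where $\mathbb{H}=\operatorname{span}\{e_0,e_1,e_2,e_3\}$ is the quaternion algebra. The sedenion algebra $S$ is the real vector space $\mathbb{O}\oplus\mathbb{O}\cong\mathbb{R}^{16}$, whose elements are written uniquely as $v=v_1+v_2e_8$ with $v_1,v_2\in\mathbb{O}$, with multiplication \[ (a+be_8)(c+de_8)=(ac-\overline{d}\,b)+(da+b\overline{c})e_8,\qquad a,b,c,d\in\mathbb{O}. \] An element $v\in S$ is a left zero-divisor if there exists $y\in S$, $y\neq 0$, with $vy=0$. *)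

theory Defs
  imports "HOL-Analysis.Analysis"
begin

text \<open>
  Quaternions, octonions and sedenions are represented by their real coordinates in nested
  product types, so that the additive structure, the scalar multiplication, the inner product and
  the norm of the library (type classes for products) are the componentwise operations and the
  standard Euclidean inner product and norm. The algebra multiplications are
  introduced as separate operations.
\<close>

type_synonym quaternion = "real \<times> real \<times> real \<times> real"

text \<open>The tuple \<open>(a, b, c, d)\<close> stands for \<open>a e\<^sub>0 + b e\<^sub>1 + c e\<^sub>2 + d e\<^sub>3\<close>, with
  \<open>e\<^sub>1 e\<^sub>2 = e\<^sub>3\<close>, \<open>e\<^sub>2 e\<^sub>3 = e\<^sub>1\<close>, \<open>e\<^sub>3 e\<^sub>1 = e\<^sub>2\<close>.\<close>

fun quat_mult :: "quaternion \<Rightarrow> quaternion \<Rightarrow> quaternion"  (infixl "*\<^sub>H" 70) where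
  "(a, b, c, d) *\<^sub>H (a', b', c', d') =
     (a * a' - b * b' - c * c' - d * d',
      a * b' + b * a' + c * d' - d * c',
      a * c' - b * d' + c * a' + d * b',
      a * d' + b * c' - c * b' + d * a')"

fun quat_cnj :: "quaternion \<Rightarrow> quaternion" where
  "quat_cnj (a, b, c, d) = (a, - b, - c, - d)"

text \<open>The pair \<open>(x, y)\<close> of quaternions stands for the octonion \<open>x + y e\<^sub>4\<close>.\<close>

type_synonym octonion = "quaternion \<times> quaternion"

fun oct_mult :: "octonion \<Rightarrow> octonion \<Rightarrow> octonion"  (infixl "*\<^sub>O" 70) where
  "(x, y) *\<^sub>O (z, t) = (x *\<^sub>H z - quat_cnj t *\<^sub>H y, t *\<^sub>H x + y *\<^sub>H quat_cnj z)"

fun oct_cnj :: "octonion \<Rightarrow> octonion" where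
  "oct_cnj (x, y) = (quat_cnj x, - y)"

definition oct_e0 :: octonion where
  "oct_e0 = ((1, 0, 0, 0), (0, 0, 0, 0))"

definition Im_oct :: "octonion set" where
  "Im_oct = {x. orthogonal oct_e0 x}"

text \<open>The pair \<open>(a, b)\<close> of octonions stands for the sedenion \<open>a + b e\<^sub>8\<close>.\<close>

type_synonym sedenion = "octonion \<times> octonion"

fun sed_mult :: "sedenion \<Rightarrow> sedenion \<Rightarrow> sedenion"  (infixl "*\<^sub>S" 70) where
  "(a, b) *\<^sub>S (c, d) = (a *\<^sub>O c - oct_cnj d *\<^sub>O b, d *\<^sub>O a + b *\<^sub>O oct_cnj c)"

definition sed_e8 :: sedenion where
  "sed_e8 = (0, oct_e0)"

definition left_zero_divisor :: "sedenion \<Rightarrow> bool" where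
  "left_zero_divisor v \<longleftrightarrow> (\<exists>y. y \<noteq> 0 \<and> v *\<^sub>S y = 0)"

lemma oct_cases:
  obtains a b c d e f g h where "(x :: octonion) = ((a, b, c, d), (e, f, g, h))"
  by (metis prod.exhaust)

lemma oct_mult_e0: "oct_e0 *\<^sub>O x = x" "x *\<^sub>O oct_e0 = x"
  by (cases x rule: oct_cases; simp add: oct_e0_def zero_prod_def)+

lemma oct_mult_cnj: "x *\<^sub>O oct_cnj x = (norm x)\<^sup>2 *\<^sub>R oct_e0"
  by (cases x rule: oct_cases)
    (simp add: oct_e0_def zero_prod_def power2_norm_eq_inner algebra_simps)

text \<open>The pair encoding agrees with the expression \<open>a + b e\<^sub>8\<close> evaluated in the algebra.\<close>

lemma sed_pair_eq: "(a, 0) + (b, 0) *\<^sub>S sed_e8 = (a, b)"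
  by (cases a rule: oct_cases; cases b rule: oct_cases)
    (simp add: sed_e8_def oct_e0_def zero_prod_def)

end

theory Submission
  imports Defs
begin

text \<open>
  The octonions form a composition algebra: left multiplication by \<open>x\<close> has the adjoint
  multiplication by \<open>oct_cnj x\<close>, and the two compose to \<open>(norm x)\<^sup>2\<close>; multiplication on the right
  behaves in the same way. For imaginary \<open>x\<close> both multiplications are therefore skew-symmetric, and
  they scale the inner product by \<open>(norm x)\<^sup>2\<close>.

  Suppose that \<open>(a, b) *\<^sub>S (c, d) = 0\<close> with \<open>(c, d) \<noteq> 0\<close>, that is, \<open>a c = d\<^sup>* b\<close> and
  \<open>d a = - b c\<^sup>*\<close>, where \<open>\<^sup>*\<close> is conjugation. Comparison of norms shows that none of the four
  entries vanishes and that \<open>norm a = norm b\<close>. The first equation can be solved for \<open>c\<close>; what the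
  second one then says is
  \<open>b\<^sup>* (d a) + (b\<^sup>* d) a = 0\<close> (\<open>zero_product_anticommutator\<close>).
  Put \<open>a = x1 + u\<close>, \<open>b = x2 + w\<close> and let \<open>A\<close> be left multiplication by \<open>w\<close> and \<open>B\<close> right
  multiplication by \<open>u\<close>. The equation becomes
  \<open>(A B + B A - 2 x1 x2) d = 2 (x2 B - x1 A) d\<close>.
  Since \<open>A\<close> and \<open>B\<close> are skew and multiples of isometries, the two sides are orthogonal, so both
  vanish. If \<open>x1\<close> and \<open>x2\<close> are both nonzero, then \<open>A d\<close> and \<open>B d\<close> are proportional and
  \<open>A B + B A\<close> acts on \<open>d\<close> with the opposite sign to \<open>2 x1 x2\<close>; if exactly one of them is nonzero,
  then \<open>a = 0\<close> or \<open>b = 0\<close>. Hence \<open>x1 = x2 = 0\<close>, and pairing \<open>w (d u) + (w d) u = 0\<close> successively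
  with \<open>w u\<close>, \<open>u\<close> and \<open>d\<close> gives that \<open>d\<close> is imaginary, that \<open>d\<close> is orthogonal to \<open>w\<close>, and finally
  that \<open>u\<close> is orthogonal to \<open>w\<close> (\<open>anticommutator_kernel_orthogonal\<close>).

  For the converse, \<open>1, u, w, w u\<close> span at most four of the eight dimensions. Any nonzero \<open>d\<close>
  orthogonal to them satisfies \<open>w (d u) + (w d) u = 0\<close>, because orthogonal imaginary octonions
  anticommute and so do the multiplications by them; with the matching \<open>c\<close> it annihilates \<open>(u, w)\<close>.
\<close>

section \<open>The octonions as a composition algebra\<close>

lemma oct_add_left: "(x + y) *\<^sub>O z = x *\<^sub>O z + y *\<^sub>O z"
  by (cases x rule: oct_cases; cases y rule: oct_cases; cases z rule: oct_cases)
    (simp add: algebra_simps)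

lemma oct_add_right: "z *\<^sub>O (x + y) = z *\<^sub>O x + z *\<^sub>O y"
  by (cases x rule: oct_cases; cases y rule: oct_cases; cases z rule: oct_cases)
    (simp add: algebra_simps)

lemma oct_scaleR_left: "(r *\<^sub>R x) *\<^sub>O z = r *\<^sub>R (x *\<^sub>O z)"
  by (cases x rule: oct_cases; cases z rule: oct_cases) (simp add: algebra_simps)

lemma oct_scaleR_right: "z *\<^sub>O (r *\<^sub>R x) = r *\<^sub>R (z *\<^sub>O x)"
  by (cases x rule: oct_cases; cases z rule: oct_cases) (simp add: algebra_simps)

lemma oct_cnj_cnj [simp]: "oct_cnj (oct_cnj x) = x"
  by (cases x rule: oct_cases) simp

lemma oct_cnj_scaleR: "oct_cnj (r *\<^sub>R x) = r *\<^sub>R oct_cnj x"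
  by (cases x rule: oct_cases) simp

lemma oct_cnj_add: "oct_cnj (x + y) = oct_cnj x + oct_cnj y"
  by (cases x rule: oct_cases; cases y rule: oct_cases) simp

lemma oct_cnj_e0 [simp]: "oct_cnj oct_e0 = oct_e0"
  by (simp add: oct_e0_def)

lemma inner_oct_cnj: "inner (oct_cnj x) (oct_cnj y) = inner x y"
  by (cases x rule: oct_cases; cases y rule: oct_cases) simp

lemma norm_oct_cnj [simp]: "norm (oct_cnj x) = norm x"
  by (simp add: norm_eq_sqrt_inner inner_oct_cnj)

lemma oct_cnj_mult: "oct_cnj (x *\<^sub>O y) = oct_cnj y *\<^sub>O oct_cnj x"
  by (cases x rule: oct_cases; cases y rule: oct_cases) (simp add: algebra_simps)

lemma inner_mult_left_adjoint: "inner (x *\<^sub>O a) b = inner a (oct_cnj x *\<^sub>O b)"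
  by (cases x rule: oct_cases; cases a rule: oct_cases; cases b rule: oct_cases)
    (simp add: algebra_simps)

lemma oct_cnj_mult_cancel_left: "oct_cnj x *\<^sub>O (x *\<^sub>O z) = (norm x)\<^sup>2 *\<^sub>R z"
  by (cases x rule: oct_cases; cases z rule: oct_cases)
    (simp add: power2_norm_eq_inner algebra_simps)

text \<open>Conjugation reverses products, which turns every law for multiplication on the left into one
  for multiplication on the right.\<close>

lemma inner_mult_right_adjoint: "inner (a *\<^sub>O x) b = inner a (b *\<^sub>O oct_cnj x)"
proof -
  have "inner (a *\<^sub>O x) b = inner (oct_cnj x *\<^sub>O oct_cnj a) (oct_cnj b)"
    by (metis inner_oct_cnj oct_cnj_mult)
  also have "\<dots> = inner (oct_cnj a) (x *\<^sub>O oct_cnj b)"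
    by (simp add: inner_mult_left_adjoint)
  also have "\<dots> = inner a (b *\<^sub>O oct_cnj x)"
    by (metis inner_oct_cnj oct_cnj_mult oct_cnj_cnj)
  finally show ?thesis .
qed

lemma oct_cnj_mult_cancel_right: "(z *\<^sub>O x) *\<^sub>O oct_cnj x = (norm x)\<^sup>2 *\<^sub>R z"
proof -
  have "oct_cnj ((z *\<^sub>O x) *\<^sub>O oct_cnj x) = oct_cnj ((norm x)\<^sup>2 *\<^sub>R z)"
    using oct_cnj_mult_cancel_left[of "oct_cnj x" "oct_cnj z"]
    by (simp add: oct_cnj_mult oct_cnj_scaleR)
  then show ?thesis by (metis oct_cnj_cnj)
qed

lemma inner_mult_left_isometry: "inner (x *\<^sub>O a) (x *\<^sub>O b) = (norm x)\<^sup>2 * inner a b"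
  by (simp add: inner_mult_left_adjoint oct_cnj_mult_cancel_left)

lemma inner_mult_right_isometry: "inner (a *\<^sub>O x) (b *\<^sub>O x) = (norm x)\<^sup>2 * inner a b"
  by (simp add: inner_mult_right_adjoint oct_cnj_mult_cancel_right)

lemma norm_oct_mult: "norm (x *\<^sub>O y) = norm x * norm y"
  by (simp add: norm_eq_sqrt_inner[of "x *\<^sub>O y"] inner_mult_left_isometry real_sqrt_mult
      flip: norm_eq_sqrt_inner)

interpretation oct: bounded_bilinear "(*\<^sub>O)"
  by unfold_locales
    (auto simp: oct_add_left oct_add_right oct_scaleR_left oct_scaleR_right norm_oct_mult
      intro: exI[of _ 1])

lemma oct_mult_eq_0_iff: "x *\<^sub>O y = 0 \<longleftrightarrow> x = 0 \<or> y = 0"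
proof -
  have "norm (x *\<^sub>O y) = 0 \<longleftrightarrow> norm x = 0 \<or> norm y = 0"
    by (simp only: norm_oct_mult mult_eq_0_iff)
  then show ?thesis by (simp only: norm_eq_zero)
qed

section \<open>Imaginary octonions\<close>

lemma Im_oct_iff_inner: "x \<in> Im_oct \<longleftrightarrow> inner oct_e0 x = 0"
  by (simp add: Im_oct_def orthogonal_def)

lemma oct_cnj_Im: "x \<in> Im_oct \<Longrightarrow> oct_cnj x = - x"
  by (cases x rule: oct_cases) (simp add: Im_oct_iff_inner oct_e0_def zero_prod_def)

lemma Im_oct_add: "x \<in> Im_oct \<Longrightarrow> y \<in> Im_oct \<Longrightarrow> x + y \<in> Im_oct"
  by (simp add: Im_oct_iff_inner inner_add_right)

lemma inner_Im_mult_left: "x \<in> Im_oct \<Longrightarrow> inner (x *\<^sub>O a) b = - inner a (x *\<^sub>O b)"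
  by (simp add: inner_mult_left_adjoint oct_cnj_Im oct.minus_left)

lemma inner_e0_mult_Im: "x \<in> Im_oct \<Longrightarrow> inner oct_e0 (x *\<^sub>O y) = - inner x y"
  using inner_Im_mult_left[of x oct_e0 y] by (simp add: oct_mult_e0)

lemma inner_Im_mult_right: "x \<in> Im_oct \<Longrightarrow> inner (a *\<^sub>O x) b = - inner a (b *\<^sub>O x)"
  by (simp add: inner_mult_right_adjoint oct_cnj_Im oct.minus_right)

lemma inner_Im_mult_self:
  assumes "x \<in> Im_oct"
  shows "inner (x *\<^sub>O a) a = 0" "inner a (x *\<^sub>O a) = 0"
    "inner (a *\<^sub>O x) a = 0" "inner a (a *\<^sub>O x) = 0"
  using inner_Im_mult_left[OF assms, of a a] inner_Im_mult_right[OF assms, of a a]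
  by (simp_all add: inner_commute)

lemma Im_mult_left_twice: "x \<in> Im_oct \<Longrightarrow> x *\<^sub>O (x *\<^sub>O z) = - ((norm x)\<^sup>2 *\<^sub>R z)"
  by (metis minus_minus oct.minus_left oct_cnj_Im oct_cnj_mult_cancel_left)

lemma Im_mult_right_twice: "x \<in> Im_oct \<Longrightarrow> (z *\<^sub>O x) *\<^sub>O x = - ((norm x)\<^sup>2 *\<^sub>R z)"
  by (metis minus_minus oct.minus_right oct_cnj_Im oct_cnj_mult_cancel_right)

text \<open>Polarisation of \<open>x (x z) = - |x|\<^sup>2 z\<close> and of its mirror image.\<close>

lemma orthogonal_Im_mult_left_anticommute:
  assumes "x \<in> Im_oct" "y \<in> Im_oct" "inner x y = 0"
  shows "x *\<^sub>O (y *\<^sub>O z) = - (y *\<^sub>O (x *\<^sub>O z))"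
  using Im_mult_left_twice[OF Im_oct_add[OF assms(1,2)], of z]
  by (simp add: norm_add_Pythagorean orthogonal_def assms Im_mult_left_twice oct.add_left oct.add_right
      eq_neg_iff_add_eq_0 algebra_simps)

lemma orthogonal_Im_mult_right_anticommute:
  assumes "x \<in> Im_oct" "y \<in> Im_oct" "inner x y = 0"
  shows "(z *\<^sub>O x) *\<^sub>O y = - ((z *\<^sub>O y) *\<^sub>O x)"
  using Im_mult_right_twice[OF Im_oct_add[OF assms(1,2)], of z]
  by (simp add: norm_add_Pythagorean orthogonal_def assms Im_mult_right_twice oct.add_left oct.add_right
      eq_neg_iff_add_eq_0 algebra_simps)

lemma orthogonal_Im_anticommute:
  assumes "x \<in> Im_oct" "y \<in> Im_oct" "inner x y = 0"
  shows "x *\<^sub>O y = - (y *\<^sub>O x)"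
  using orthogonal_Im_mult_left_anticommute[OF assms, of oct_e0] by (simp add: oct_mult_e0)

section \<open>Entries of vanishing sedenion products\<close>

lemma sed_mult_eq_0_iff:
  "(a, b) *\<^sub>S (c, d) = 0 \<longleftrightarrow> a *\<^sub>O c = oct_cnj d *\<^sub>O b \<and> d *\<^sub>O a = - (b *\<^sub>O oct_cnj c)"
  by (simp add: zero_prod_def[where 'a = octonion and 'b = octonion] eq_neg_iff_add_eq_0)

text \<open>Taking norms turns the two equations into \<open>|a| |c| = |d| |b|\<close> and \<open>|d| |a| = |b| |c|\<close>.\<close>

lemma zero_product_norms:
  assumes "(a, b) \<noteq> 0" "(c, d) \<noteq> 0"
    and "a *\<^sub>O c = oct_cnj d *\<^sub>O b" "d *\<^sub>O a = - (b *\<^sub>O oct_cnj c)"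
  shows "a \<noteq> 0" "b \<noteq> 0" "d \<noteq> 0" "norm a = norm b"
proof -
  have n1: "norm a * norm c = norm d * norm b"
    by (metis assms(3) norm_oct_mult norm_oct_cnj)
  have n2: "norm d * norm a = norm b * norm c"
    by (metis assms(4) norm_oct_mult norm_oct_cnj norm_minus_cancel)
  have z: "a \<noteq> 0 \<or> b \<noteq> 0" "c \<noteq> 0 \<or> d \<noteq> 0"
    using assms(1,2) by (auto simp: zero_prod_def[where 'a = octonion and 'b = octonion])
  show a: "a \<noteq> 0" and b: "b \<noteq> 0" and d: "d \<noteq> 0"
    using z n1 n2 by auto
  have "norm d * norm a * norm a = norm b * (norm a * norm c)"
    by (simp add: n2)
  then have "norm d * (norm a)\<^sup>2 = norm d * (norm b)\<^sup>2"
    by (simp add: n1 power2_eq_square)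
  then show "norm a = norm b" using d by simp
qed

text \<open>Eliminating \<open>c\<close> leaves a linear condition on \<open>d\<close>: the first equation, multiplied by
  \<open>oct_cnj a\<close>, expresses \<open>c\<close> through \<open>d\<close>; the second one is then multiplied by \<open>oct_cnj b\<close>.\<close>

lemma zero_product_anticommutator:
  assumes "norm a = norm b"
    and eq1: "a *\<^sub>O c = oct_cnj d *\<^sub>O b" and eq2: "d *\<^sub>O a = - (b *\<^sub>O oct_cnj c)"
  shows "oct_cnj b *\<^sub>O (d *\<^sub>O a) + (oct_cnj b *\<^sub>O d) *\<^sub>O a = 0"
proof -
  have "(norm b)\<^sup>2 *\<^sub>R c = oct_cnj a *\<^sub>O (oct_cnj d *\<^sub>O b)"
    by (metis assms(1) eq1 oct_cnj_mult_cancel_left)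
  then have "oct_cnj ((norm b)\<^sup>2 *\<^sub>R c) = (oct_cnj b *\<^sub>O d) *\<^sub>O a"
    by (simp add: oct_cnj_mult)
  then have "(norm b)\<^sup>2 *\<^sub>R oct_cnj c = (oct_cnj b *\<^sub>O d) *\<^sub>O a"
    by (simp add: oct_cnj_scaleR)
  moreover have "oct_cnj b *\<^sub>O (d *\<^sub>O a) = - ((norm b)\<^sup>2 *\<^sub>R oct_cnj c)"
    by (simp add: eq2 oct.minus_right oct_cnj_mult_cancel_left)
  ultimately show ?thesis by simp
qed

text \<open>Each of the four pairings reduces, if necessary after a common factor has been cancelled by
  isometry, to the pairing of an octonion with its own product by \<open>u\<close> or \<open>w\<close>, and this is zero by
  skewness. The lemma is what separates the symmetric from the skew part of the condition on \<open>d\<close>.\<close>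

lemma inner_anticommutator:
  assumes "u \<in> Im_oct" "w \<in> Im_oct"
  shows "inner (w *\<^sub>O (d *\<^sub>O u) + (w *\<^sub>O d) *\<^sub>O u) (w *\<^sub>O d) = 0"
    and "inner (w *\<^sub>O (d *\<^sub>O u) + (w *\<^sub>O d) *\<^sub>O u) (d *\<^sub>O u) = 0"
  using assms
  by (simp_all add: inner_add_left inner_mult_left_isometry inner_mult_right_isometry
      inner_Im_mult_self)

text \<open>Expanding the condition gives \<open>M - 2 x1 x2 d = 2 C\<close> with \<open>M = w (d u) + (w d) u\<close> and
  \<open>C = x2 (d u) - x1 (w d)\<close>. Since \<open>C\<close> is orthogonal to \<open>M\<close> and to \<open>d\<close>, it vanishes, and
  \<open>M = 2 x1 x2 d\<close>. Multiplied by \<open>x1 x2\<close>, the right-hand side is a nonnegative multiple of \<open>d\<close>,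
  whereas \<open>C = 0\<close> makes the left-hand side a nonpositive one, so that \<open>x1 x2 = 0\<close>.\<close>

lemma anticommutator_kernel_real_parts:
  assumes u: "u \<in> Im_oct" and w: "w \<in> Im_oct" and d: "d \<noteq> 0"
    and a: "x1 *\<^sub>R oct_e0 + u \<noteq> 0" and b: "x2 *\<^sub>R oct_e0 + w \<noteq> 0"
    and eq: "oct_cnj (x2 *\<^sub>R oct_e0 + w) *\<^sub>O (d *\<^sub>O (x1 *\<^sub>R oct_e0 + u))
      + (oct_cnj (x2 *\<^sub>R oct_e0 + w) *\<^sub>O d) *\<^sub>O (x1 *\<^sub>R oct_e0 + u) = 0"
  shows "x1 = 0 \<and> x2 = 0"
proof -
  define M where "M = w *\<^sub>O (d *\<^sub>O u) + (w *\<^sub>O d) *\<^sub>O u"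
  define C where "C = x2 *\<^sub>R (d *\<^sub>O u) - x1 *\<^sub>R (w *\<^sub>O d)"
  have cnj: "oct_cnj (x2 *\<^sub>R oct_e0 + w) = x2 *\<^sub>R oct_e0 - w"
    by (simp add: oct_cnj_add oct_cnj_scaleR oct_cnj_Im w)
  have "M - ((x1 * x2) *\<^sub>R d + (x1 * x2) *\<^sub>R d) = C + C"
    using eq unfolding cnj M_def C_def
    by (simp add: oct.add_left oct.add_right oct.diff_left oct.diff_right oct.scaleR_left
        oct.scaleR_right oct_mult_e0 algebra_simps)
  moreover have "(x1 * x2) *\<^sub>R d + (x1 * x2) *\<^sub>R d = (2 * x1 * x2) *\<^sub>R d"
    by (simp flip: scaleR_add_left)
  ultimately have MC: "M - (2 * x1 * x2) *\<^sub>R d = 2 *\<^sub>R C"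
    by (simp add: scaleR_2)
  have "inner M C = 0"
    by (simp add: M_def C_def inner_diff_right inner_anticommutator[OF u w])
  moreover have "inner d C = 0"
    by (simp add: C_def inner_diff_right inner_Im_mult_self u w)
  ultimately have "inner (2 *\<^sub>R C) C = 0"
    by (simp flip: MC add: inner_diff_left)
  then have C: "C = 0" by simp
  then have M: "M = (2 * x1 * x2) *\<^sub>R d" using MC by simp
  have proportional: "x2 *\<^sub>R (d *\<^sub>O u) = x1 *\<^sub>R (w *\<^sub>O d)" using C by (simp add: C_def)
  \<comment> \<open>Replace \<open>x2 (d u)\<close> by \<open>x1 (w d)\<close> in the first summand of \<open>x1 x2 M\<close>, and the other way round in
    the second, so that each summand becomes a square acting on \<open>d\<close>.\<close>
  have "(x1 * x2) *\<^sub>R M = x1 *\<^sub>R (w *\<^sub>O (x2 *\<^sub>R (d *\<^sub>O u))) + x2 *\<^sub>R ((x1 *\<^sub>R (w *\<^sub>O d)) *\<^sub>O u)"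
    by (simp add: M_def oct.scaleR_left oct.scaleR_right scaleR_add_right mult.commute)
  also have "\<dots> = x1 *\<^sub>R (w *\<^sub>O (x1 *\<^sub>R (w *\<^sub>O d))) + x2 *\<^sub>R ((x2 *\<^sub>R (d *\<^sub>O u)) *\<^sub>O u)"
    by (simp only: proportional)
  also have "\<dots> = - (x1\<^sup>2 * (norm w)\<^sup>2 + x2\<^sup>2 * (norm u)\<^sup>2) *\<^sub>R d"
    by (simp add: oct.scaleR_left oct.scaleR_right Im_mult_left_twice Im_mult_right_twice u w
        scaleR_add_left scaleR_diff_left power2_eq_square mult.assoc)
  finally have "(x1 * x2 * (2 * x1 * x2)) *\<^sub>R d
      = (- (x1\<^sup>2 * (norm w)\<^sup>2 + x2\<^sup>2 * (norm u)\<^sup>2)) *\<^sub>R d"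
    by (simp add: M)
  then have "x1 * x2 * (2 * x1 * x2) = - (x1\<^sup>2 * (norm w)\<^sup>2 + x2\<^sup>2 * (norm u)\<^sup>2)"
    using d by (metis scaleR_cancel_right)
  then have "2 * (x1 * x2)\<^sup>2 = - (x1\<^sup>2 * (norm w)\<^sup>2 + x2\<^sup>2 * (norm u)\<^sup>2)"
    by (simp add: power2_eq_square mult_ac)
  then have "2 * (x1 * x2)\<^sup>2 \<le> 0"
    by (metis add_nonneg_nonneg mult_nonneg_nonneg neg_le_0_iff_le zero_le_power2)
  then have "x1 * x2 = 0" by simp
  then consider "x1 = 0" "x2 \<noteq> 0" | "x1 \<noteq> 0" "x2 = 0" | "x1 = 0" "x2 = 0" by auto
  then show ?thesis
  proof cases
    case 1
    then show ?thesis using proportional a d by (simp add: oct_mult_eq_0_iff)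
  next
    case 2
    then show ?thesis using proportional b d by (simp add: oct_mult_eq_0_iff)
  qed simp
qed

text \<open>Pairing the equation with \<open>w u\<close>, \<open>u\<close> and \<open>d\<close> in turn reads off the real part of \<open>d\<close>, then
  \<open>inner w d\<close>, then \<open>inner u w\<close>. The last step uses the first two, because only for imaginary \<open>d\<close>
  orthogonal to \<open>w\<close> can \<open>w d\<close> be replaced by \<open>- d w\<close>.\<close>

lemma anticommutator_kernel_orthogonal:
  assumes u: "u \<in> Im_oct" "u \<noteq> 0" and w: "w \<in> Im_oct" "w \<noteq> 0" and d: "d \<noteq> 0"
    and eq: "w *\<^sub>O (d *\<^sub>O u) + (w *\<^sub>O d) *\<^sub>O u = 0"
  shows "inner u w = 0"
proof -
  have pair: "inner (w *\<^sub>O (d *\<^sub>O u)) z + inner ((w *\<^sub>O d) *\<^sub>O u) z = 0" for z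
    by (metis eq inner_add_left inner_zero_left)
  have e0u: "inner (x *\<^sub>O u) u = (norm u)\<^sup>2 * inner oct_e0 x" for x
    using inner_mult_right_isometry[of x u oct_e0] by (simp add: oct_mult_e0 inner_commute)
  have e0w: "inner (w *\<^sub>O x) w = (norm w)\<^sup>2 * inner oct_e0 x" for x
    using inner_mult_left_isometry[of w x oct_e0] by (simp add: oct_mult_e0 inner_commute)
  have "2 * ((norm u)\<^sup>2 * ((norm w)\<^sup>2 * inner oct_e0 d)) = 0"
    using pair[of "w *\<^sub>O u"]
    by (auto simp: inner_mult_left_isometry inner_mult_right_isometry e0u e0w)
  then have dIm: "d \<in> Im_oct" using u w by (simp add: Im_oct_iff_inner)
  have "2 * ((norm u)\<^sup>2 * inner w d) = 0"
    using pair[of u] w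
    by (auto simp: inner_Im_mult_left inner_mult_right_isometry e0u inner_e0_mult_Im
        inner_commute[of d w])
  then have "inner w d = 0" using u by simp
  then have wd: "w *\<^sub>O d = - (d *\<^sub>O w)" using orthogonal_Im_anticommute[of w d] w dIm by simp
  have "inner (d *\<^sub>O u) (w *\<^sub>O d) = 0"
    using pair[of d] u w
    by (simp add: inner_Im_mult_left inner_Im_mult_right inner_commute[of "w *\<^sub>O d"])
  then show ?thesis using d by (simp add: wd inner_mult_left_isometry)
qed

section \<open>Annihilators of orthogonal imaginary pairs\<close>

lemma exists_nonzero_orthogonal_to_four:
  fixes p q r s :: octonion
  obtains d :: octonion where "d \<noteq> 0" "inner d p = 0" "inner d q = 0" "inner d r = 0" "inner d s = 0"
proof -
  have "dim {p, q, r, s} \<le> card {p, q, r, s}" by (rule dim_le_card) (auto intro: span_base)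
  also have "\<dots> \<le> 4" by (simp add: card_insert_if)
  finally have "dim {p, q, r, s} < DIM(octonion)" by simp
  then obtain d where d: "d \<noteq> 0" "\<And>y. y \<in> span {p, q, r, s} \<Longrightarrow> orthogonal d y"
    by (rule orthogonal_to_subspace_exists) blast
  have "inner d y = 0" if "y \<in> {p, q, r, s}" for y
    using d(2)[OF span_base[OF that]] by (simp add: orthogonal_def)
  then show ?thesis using that d(1) by blast
qed

text \<open>Orthogonal imaginary octonions anticommute, and so do the multiplications by them, whence
  \<open>w (d u) = - d (w u) = (w u) d = - (w d) u\<close>. The middle step also needs \<open>w u\<close> to be imaginary,
  which is what \<open>inner u w = 0\<close> provides.\<close>

lemma anticommutator_kernelI:
  assumes u: "u \<in> Im_oct" and w: "w \<in> Im_oct" and uw: "inner u w = 0"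
    and d: "d \<in> Im_oct" "inner d u = 0" "inner d w = 0" "inner d (w *\<^sub>O u) = 0"
  shows "w *\<^sub>O (d *\<^sub>O u) = - ((w *\<^sub>O d) *\<^sub>O u)"
proof -
  have "w *\<^sub>O u \<in> Im_oct"
    using inner_e0_mult_Im[OF w] uw by (simp add: Im_oct_iff_inner inner_commute)
  then have "d *\<^sub>O (w *\<^sub>O u) = - ((w *\<^sub>O u) *\<^sub>O d)"
    using orthogonal_Im_anticommute[of d "w *\<^sub>O u"] d by simp
  moreover have "w *\<^sub>O (d *\<^sub>O u) = - (d *\<^sub>O (w *\<^sub>O u))"
    using orthogonal_Im_mult_left_anticommute[of d w u] w d by simp
  moreover have "(w *\<^sub>O d) *\<^sub>O u = - ((w *\<^sub>O u) *\<^sub>O d)"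
    using orthogonal_Im_mult_right_anticommute[of d u w] u d by simp
  ultimately show ?thesis by simp
qed

lemma orthogonal_Im_pair_zero_divisor:
  assumes u: "u \<in> Im_oct" "u \<noteq> 0" and w: "w \<in> Im_oct"
    and uw: "inner u w = 0" and n: "norm u = norm w"
  shows "left_zero_divisor (u, w)"
proof -
  obtain d where d: "d \<noteq> 0" "inner d oct_e0 = 0" "inner d u = 0" "inner d w = 0"
      "inner d (w *\<^sub>O u) = 0"
    by (rule exists_nonzero_orthogonal_to_four)
  have w0: "w \<noteq> 0" using u(2) n by auto
  have dIm: "d \<in> Im_oct" using d by (simp add: Im_oct_iff_inner inner_commute)
  have K: "w *\<^sub>O (d *\<^sub>O u) = - ((w *\<^sub>O d) *\<^sub>O u)"
    using anticommutator_kernelI[of u w d] u w uw d dIm by simp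
  \<comment> \<open>Solve \<open>u c = oct_cnj d w = - d w\<close> for \<open>c\<close>: the inverse of \<open>u\<close> is \<open>- u\<close> divided by \<open>(norm u)\<^sup>2\<close>.\<close>
  define c where "c = (1 / (norm u)\<^sup>2) *\<^sub>R (u *\<^sub>O (d *\<^sub>O w))"
  have "u *\<^sub>O c = oct_cnj d *\<^sub>O w"
    using u dIm by (simp add: c_def oct.scaleR_right Im_mult_left_twice oct_cnj_Im oct.minus_left)
  moreover have "oct_cnj c = - ((1 / (norm u)\<^sup>2) *\<^sub>R ((w *\<^sub>O d) *\<^sub>O u))"
    using u w dIm
    by (simp add: c_def oct_cnj_scaleR oct_cnj_mult oct_cnj_Im oct.minus_left oct.minus_right)
  then have "oct_cnj c = (1 / (norm u)\<^sup>2) *\<^sub>R (w *\<^sub>O (d *\<^sub>O u))"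
    by (simp add: K)
  then have "d *\<^sub>O u = - (w *\<^sub>O oct_cnj c)"
    using u w n w0 by (simp add: oct.scaleR_right Im_mult_left_twice)
  ultimately have "(u, w) *\<^sub>S (c, d) = 0" by (simp only: sed_mult_eq_0_iff)
  moreover have "(c, d) \<noteq> 0"
    using d by (simp add: zero_prod_def[where 'a = octonion and 'b = octonion])
  ultimately show ?thesis unfolding left_zero_divisor_def by blast
qed

section \<open>The characterisation\<close>

theorem corollary3p8:
  fixes v :: sedenion and v1 v2 u w :: octonion and x1 x2 :: real
  assumes "v \<noteq> 0"
    and "v = (v1, v2)"
    and "v1 = x1 *\<^sub>R oct_e0 + u"
    and "v2 = x2 *\<^sub>R oct_e0 + w"
    and "u \<in> Im_oct"
    and "w \<in> Im_oct"
  shows "left_zero_divisor v \<longleftrightarrow>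
           x1 = 0 \<and> x2 = 0 \<and> norm u = norm w \<and> inner u w = 0"
proof
  assume "left_zero_divisor v"
  then obtain c d where cd: "(c, d) \<noteq> 0" "(v1, v2) *\<^sub>S (c, d) = 0"
    unfolding left_zero_divisor_def assms(2) by (metis prod.exhaust)
  have eqs: "v1 *\<^sub>O c = oct_cnj d *\<^sub>O v2" "d *\<^sub>O v1 = - (v2 *\<^sub>O oct_cnj c)"
    using cd(2) by (simp_all only: sed_mult_eq_0_iff)
  have "(v1, v2) \<noteq> 0" using assms(1,2) by simp
  note nz = zero_product_norms[OF this cd(1) eqs]
  have K: "oct_cnj v2 *\<^sub>O (d *\<^sub>O v1) + (oct_cnj v2 *\<^sub>O d) *\<^sub>O v1 = 0"
    using zero_product_anticommutator nz eqs by blast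
  have x: "x1 = 0 \<and> x2 = 0"
    using anticommutator_kernel_real_parts[of u w d x1 x2] K nz assms by blast
  then have v: "v1 = u" "v2 = w" using assms by simp_all
  have "w *\<^sub>O (d *\<^sub>O u) + (w *\<^sub>O d) *\<^sub>O u = 0"
    using K by (simp add: v oct_cnj_Im assms oct.minus_left add_eq_0_iff)
  then have "inner u w = 0"
    using anticommutator_kernel_orthogonal nz assms(5,6) unfolding v by blast
  then show "x1 = 0 \<and> x2 = 0 \<and> norm u = norm w \<and> inner u w = 0"
    using x nz(4) v by simp
next
  assume r: "x1 = 0 \<and> x2 = 0 \<and> norm u = norm w \<and> inner u w = 0"
  then have v: "v = (u, w)" using assms by simp
  have "u \<noteq> 0"
    using assms(1) r by (auto simp: v zero_prod_def[where 'a = octonion and 'b = octonion])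
  then show "left_zero_divisor v"
    using orthogonal_Im_pair_zero_divisor r assms(5,6) unfolding v by blast
qed

end
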